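(* Let $P\in\mathbb{R}^{p\times m}$, $Y_d\in\mathbb{R}^p$, and consider the plant $Y_k=PU_k+N_k$ with tracking error $E_k=Y_d-Y_k$, so that $E_{k+1}=E_k+P\bar U_k+D_k$ with $\bar U_k=-\Delta U_k$, $D_k=-\Delta N_k$. Let $K\in\mathbb{R}^{m\times p}$ and apply the $k$-state feedback $\bar U_k=-KE_k$ for all $k\in\mathbb{Z}_+$ (equivalently, the updating law $U_{k+1}=U_k+KE_k$). Then the resulting closed-loop system is robustly $k$-stable if and only if $\rho(I_p-PK)<1$.
   Context: Notation: $\mathbb{Z}_+=\{0,1,2,\dots\}$. For a sequence $(f_k)_{k\in\mathbb{Z}_+}$, $\Delta f_k=f_{k+1}-f_k$ and $\Delta^2 f_k=\Delta(\Delta f_k)$. $\|\cdot\|$ is a fixed vector norm, $\rho(\cdot)$ the spectral radius. In the plant, $U_k\in\mathbb{R}^m$ is the input, $Y_k\in\mathbb{R}^p$ the output, and $(N_k)_{k\in\mathbb{Z}_+}\subset\mathbb{R}^p$ an unknown bounded (iteration-varying) uncertainty sequence. Define $\beta_{\Delta N}=\sup_{k}\|\Delta N_k\|$ and $\beta^{ess}_{\Delta N}=\limsup_{k\to\infty}\|\Delta N_k\|$. A closed-loop system formed by this plant and an updating law for $U_k$ is called robustly $k$-stable if there exist class-$\mathcal{K}_\infty$ functions $\chi_1,\chi_2$ and a class-$\mathcal{KL}$ function $\zeta$ such that for every bounded initial condition $E_0$ (i.e. every initial input $U_0$) and every bounded uncertainty $(N_k)$ there is a finite bound $\beta_0\ge0$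 (generally depending on the initial condition) with (boundedness) $\|E_k\|\le\chi_1(\beta_{\Delta N})+\zeta(\beta_0,k)$ for all $k\in\mathbb{Z}_+$, and (attractiveness) $\limsup_{k\to\infty}\|E_k\|\le\chi_2(\beta^{ess}_{\Delta N})$. *)

theory Defs
  imports "HOL-Analysis.Analysis"
begin

text \<open>Comparison functions (domain [0, infinity)).\<close>
definition class_K :: "(real \<Rightarrow> real) \<Rightarrow> bool" where
  "class_K f \<longleftrightarrow> continuous_on {0..} f \<and> f 0 = 0 \<and> strict_mono_on {0..} f"

definition class_Kinf :: "(real \<Rightarrow> real) \<Rightarrow> bool" where
  "class_Kinf f \<longleftrightarrow> class_K f \<and> filterlim f at_top at_top"

definition class_KL :: "(real \<Rightarrow> nat \<Rightarrow> real) \<Rightarrow> bool" where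
  "class_KL z \<longleftrightarrow> (\<forall>k. class_K (\<lambda>r. z r k)) \<and>
     (\<forall>r\<ge>0. antimono (\<lambda>k. z r k) \<and> (\<lambda>k. z r k) \<longlonglongrightarrow> 0)"

text \<open>Spectral radius of a real square matrix: largest modulus of its (complex) eigenvalues.\<close>
definition cmat :: "real^'n^'n \<Rightarrow> complex^'n^'n" where
  "cmat A = (\<chi> i j. complex_of_real (A $ i $ j))"

definition spectral_radius :: "real^'n^'n \<Rightarrow> real" where
  "spectral_radius A =
     Sup {cmod l | l. \<exists>v::complex^'n. v \<noteq> 0 \<and> cmat A *v v = l *s v}"

text \<open>Closed loop: input sequence generated by U_{k+1} = U_k + K E_k, with
  E_k = Yd - Y_k, Y_k = P U_k + N_k.\<close>
fun ilc_input :: "real^'m^'p \<Rightarrow> real^'p^'m \<Rightarrow> real^'p \<Rightarrow> (nat \<Rightarrow> real^'p) \<Rightarrow> real^'m \<Rightarrow> nat \<Rightarrow> real^'m" where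
  "ilc_input P K Yd N U0 0 = U0"
| "ilc_input P K Yd N U0 (Suc k) =
     ilc_input P K Yd N U0 k + K *v (Yd - (P *v ilc_input P K Yd N U0 k + N k))"

definition ilc_error :: "real^'m^'p \<Rightarrow> real^'p^'m \<Rightarrow> real^'p \<Rightarrow> (nat \<Rightarrow> real^'p) \<Rightarrow> real^'m \<Rightarrow> nat \<Rightarrow> real^'p" where
  "ilc_error P K Yd N U0 k = Yd - (P *v ilc_input P K Yd N U0 k + N k)"

definition beta_DN :: "(nat \<Rightarrow> 'a::real_normed_vector) \<Rightarrow> real" where
  "beta_DN N = (SUP k. norm (N (Suc k) - N k))"

definition beta_DN_ess :: "(nat \<Rightarrow> 'a::real_normed_vector) \<Rightarrow> real" where
  "beta_DN_ess N = real_of_ereal (limsup (\<lambda>k. ereal (norm (N (Suc k) - N k))))"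

definition robustly_k_stable :: "real^'m^'p \<Rightarrow> real^'p^'m \<Rightarrow> real^'p \<Rightarrow> bool" where
  "robustly_k_stable P K Yd \<longleftrightarrow>
    (\<exists>chi1 chi2 zeta. class_Kinf chi1 \<and> class_Kinf chi2 \<and> class_KL zeta \<and>
      (\<forall>U0 N. bounded (range N) \<longrightarrow>
         (\<exists>beta0\<ge>0.
            (\<forall>k. norm (ilc_error P K Yd N U0 k) \<le> chi1 (beta_DN N) + zeta beta0 k) \<and>
            limsup (\<lambda>k. ereal (norm (ilc_error P K Yd N U0 k))) \<le> ereal (chi2 (beta_DN_ess N)))))"

end

(* With A = I - PK the tracking error obeys E_{k+1} = A E_k + D_k, where D_k = N_k - N_{k+1}.

   If rho(A) < 1, pick rho(A) < r < 1: the Jordan normal form bounds all powers of A/r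
   uniformly, so |A^k x| <= c r^k |x|. Variation of constants then gives
   |E_k| <= c r^k |E_0| + c/(1 - r) sup |D|, and the same estimate applied to the tails of
   (E_k) bounds limsup |E_k| by c/(1 - r) limsup |D_k|; linear gains and an exponential
   KL function witness robust k-stability.

   Conversely, the constant uncertainty N_k = Y_d - x has D = 0 and E_k = A^k x, so robust
   k-stability forces A^k x --> 0 for every real x. Splitting a complex eigenvector into
   real and imaginary parts, the eigenvalue l then satisfies l^k --> 0, i.e. |l| < 1. *)

theory Submission
  imports "Jordan_Normal_Form.Spectral_Radius" Defs
begin

(* Jordan_Normal_Form indexes vectors and matrices by natural numbers; a fixed enumeration
   of the finite index type transfers the HOL-Analysis ("hma") ones to them. *)

definition enum_pos :: "'n::finite \<Rightarrow> nat" where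
  "enum_pos = (SOME h. bij_betw h (UNIV::'n set) {0..<CARD('n)})"

definition enum_elem :: "nat \<Rightarrow> 'n::finite" where
  "enum_elem = inv_into UNIV enum_pos"

lemma bij_betw_enum_pos: "bij_betw (enum_pos :: 'n::finite \<Rightarrow> nat) UNIV {0..<CARD('n)}"
proof -
  obtain h where "bij_betw h (UNIV::'n set) {0..<CARD('n)}"
    using ex_bij_betw_finite_nat[of "UNIV::'n set"] by auto
  then show ?thesis
    unfolding enum_pos_def by (metis someI)
qed

lemma bij_betw_enum_elem: "bij_betw (enum_elem :: nat \<Rightarrow> 'n::finite) {0..<CARD('n)} UNIV"
  unfolding enum_elem_def by (rule bij_betw_inv_into[OF bij_betw_enum_pos])

lemma enum_pos_less [simp]: "enum_pos (a::'n::finite) < CARD('n)"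
  using bij_betw_enum_pos[where 'n='n] by (auto dest: bij_betwE)

lemma enum_pos_enum_elem [simp]:
  "i < CARD('n::finite) \<Longrightarrow> enum_pos (enum_elem i :: 'n) = i"
  unfolding enum_elem_def using bij_betw_enum_pos[where 'n='n]
  by (simp add: bij_betw_inv_into_right)

lemma enum_elem_enum_pos [simp]: "enum_elem (enum_pos a) = (a::'n::finite)"
  unfolding enum_elem_def using bij_betw_enum_pos[where 'n='n]
  by (simp add: bij_betw_imp_inj_on)

definition vec_of_hma :: "'a^'n::finite \<Rightarrow> 'a Matrix.vec" where
  "vec_of_hma v = Matrix.vec CARD('n) (\<lambda>i. vec_nth v (enum_elem i))"

definition hma_of_vec :: "'a Matrix.vec \<Rightarrow> 'a^'n::finite" where
  "hma_of_vec w = (\<chi> a. vec_index w (enum_pos a))"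

definition mat_of_hma :: "'a^'n::finite^'m::finite \<Rightarrow> 'a mat" where
  "mat_of_hma M =
     Matrix.mat CARD('m) CARD('n) (\<lambda>(i, j). vec_nth (vec_nth M (enum_elem i)) (enum_elem j))"

lemma vec_of_hma_carrier [simp]: "vec_of_hma (v::'a^'n::finite) \<in> carrier_vec CARD('n)"
  unfolding vec_of_hma_def by simp

lemma mat_of_hma_carrier [simp]:
  "mat_of_hma (M::'a^'n::finite^'m::finite) \<in> carrier_mat CARD('m) CARD('n)"
  unfolding mat_of_hma_def by simp

lemma dim_mat_of_hma [simp]:
  "dim_row (mat_of_hma (M::'a^'n::finite^'m::finite)) = CARD('m)"
  "dim_col (mat_of_hma (M::'a^'n::finite^'m::finite)) = CARD('n)"
  unfolding mat_of_hma_def by simp_all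

lemma vec_of_hma_inverse [simp]:
  "w \<in> carrier_vec CARD('n) \<Longrightarrow> vec_of_hma (hma_of_vec w :: 'a^'n::finite) = w"
  unfolding vec_of_hma_def hma_of_vec_def by auto

lemma hma_of_vec_inverse [simp]: "hma_of_vec (vec_of_hma v) = (v::'a^'n::finite)"
  unfolding vec_of_hma_def hma_of_vec_def by (simp add: vec_eq_iff)

lemma vec_of_hma_zero [simp]: "vec_of_hma (0::'a::zero^'n::finite) = 0\<^sub>v CARD('n)"
  unfolding vec_of_hma_def by auto

lemma vec_of_hma_smult:
  "vec_of_hma (c *s (v::'a::times^'n::finite)) = c \<cdot>\<^sub>v vec_of_hma v"
  unfolding vec_of_hma_def by auto

lemma mat_of_hma_mult_vec:
  fixes M :: "'a::semiring_1^'n::finite^'m::finite"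
  shows "mat_of_hma M *\<^sub>v vec_of_hma v = vec_of_hma (M *v v)"
proof (rule eq_vecI)
  fix i assume "i < dim_vec (vec_of_hma (M *v v))"
  then have i: "i < CARD('m)"
    unfolding vec_of_hma_def by simp
  have "vec_index (mat_of_hma M *\<^sub>v vec_of_hma v) i =
      (\<Sum>j = 0..<CARD('n). vec_nth (vec_nth M (enum_elem i)) (enum_elem j) * vec_nth v (enum_elem j))"
    using i unfolding mat_of_hma_def vec_of_hma_def by (simp add: scalar_prod_def)
  also have "\<dots> = (\<Sum>a\<in>UNIV. vec_nth (vec_nth M (enum_elem i)) a * vec_nth v a)"
    by (rule sum.reindex_bij_betw[OF bij_betw_enum_elem])
  also have "\<dots> = vec_index (vec_of_hma (M *v v)) i"
    using i unfolding vec_of_hma_def by (simp add: matrix_vector_mult_def)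
  finally show "vec_index (mat_of_hma M *\<^sub>v vec_of_hma v) i = vec_index (vec_of_hma (M *v v)) i"
    .
qed (simp add: mat_of_hma_def vec_of_hma_def)

lemma mat_of_hma_pow_mult_vec:
  fixes M :: "'a::comm_semiring_1^'n::finite^'n"
  shows "mat_of_hma M ^\<^sub>m k *\<^sub>v vec_of_hma v = vec_of_hma (((*v) M ^^ k) v)"
proof (induction k arbitrary: v)
  case 0
  show ?case
    using vec_of_hma_carrier[of v] by (simp add: mat_of_hma_def)
next
  case (Suc k)
  have "mat_of_hma M ^\<^sub>m Suc k *\<^sub>v vec_of_hma v =
      mat_of_hma M ^\<^sub>m k *\<^sub>v (mat_of_hma M *\<^sub>v vec_of_hma v)"
    by (simp add: assoc_mult_mat_vec[OF pow_carrier_mat[OF mat_of_hma_carrier] mat_of_hma_carrier])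
  also have "\<dots> = vec_of_hma (((*v) M ^^ Suc k) v)"
    by (simp add: mat_of_hma_mult_vec Suc funpow_Suc_right del: funpow.simps)
  finally show ?case .
qed

lemma eigenvalue_mat_of_hma_iff:
  fixes M :: "'a::comm_ring_1^'n::finite^'n"
  shows "eigenvalue (mat_of_hma M) l \<longleftrightarrow> (\<exists>v. v \<noteq> 0 \<and> M *v v = l *s v)"
proof
  assume "eigenvalue (mat_of_hma M) l"
  then obtain w where w: "w \<in> carrier_vec CARD('n)" "w \<noteq> 0\<^sub>v CARD('n)"
    "mat_of_hma M *\<^sub>v w = l \<cdot>\<^sub>v w"
    unfolding eigenvalue_def eigenvector_def by auto
  define v :: "'a^'n" where "v = hma_of_vec w"
  have w_eq: "w = vec_of_hma v"
    unfolding v_def using w(1) by simp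
  have "v \<noteq> 0"
    using w(2) w_eq by auto
  moreover have "vec_of_hma (M *v v) = vec_of_hma (l *s v)"
    using w(3) by (simp add: w_eq mat_of_hma_mult_vec vec_of_hma_smult)
  then have "M *v v = l *s v"
    by (metis hma_of_vec_inverse)
  ultimately show "\<exists>v. v \<noteq> 0 \<and> M *v v = l *s v" by blast
next
  assume "\<exists>v. v \<noteq> 0 \<and> M *v v = l *s v"
  then obtain v where v: "v \<noteq> 0" "M *v v = l *s v" by blast
  have "vec_of_hma v \<noteq> 0\<^sub>v CARD('n)"
    using v(1) by (metis hma_of_vec_inverse vec_of_hma_zero)
  then show "eigenvalue (mat_of_hma M) l"
    unfolding eigenvalue_def eigenvector_def
    by (intro exI[of _ "vec_of_hma v"]) (simp add: mat_of_hma_mult_vec v(2) vec_of_hma_smult)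
qed

lemma spectral_radius_cmat:
  "Defs.spectral_radius (A::real^'n::finite^'n) =
     Spectral_Radius.spectral_radius (mat_of_hma (cmat A))"
proof -
  let ?S = "spectrum (mat_of_hma (cmat A))"
  have eq: "{cmod l | l. \<exists>v::complex^'n. v \<noteq> 0 \<and> cmat A *v v = l *s v} = norm ` ?S"
    unfolding spectrum_def image_def by (auto simp: eigenvalue_mat_of_hma_iff)
  have "finite ?S"
    by (rule card_finite_spectrum(1)[OF mat_of_hma_carrier])
  moreover have "?S \<noteq> {}"
    by (rule spectrum_non_empty[OF mat_of_hma_carrier]) simp
  ultimately show ?thesis
    unfolding Defs.spectral_radius_def Spectral_Radius.spectral_radius_def eq
    by (simp add: cSup_eq_Max)
qed

lemma norm_le_sum_norm_nth:
  "norm (v::'a::real_normed_vector^'n::finite) \<le> (\<Sum>a\<in>UNIV. norm (vec_nth v a))"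
  unfolding norm_vec_def by (rule L2_set_le_sum) simp

lemma norm_mult_mat_vec_le_norm_bound:
  fixes v :: "complex^'n::finite" and b :: real
  assumes B: "B \<in> carrier_mat CARD('n) CARD('n)" and bound: "norm_bound B b"
  shows "norm (hma_of_vec (B *\<^sub>v vec_of_hma v) :: complex^'n) \<le>
    real CARD('n) * real CARD('n) * b * norm v"
proof -
  let ?n = "CARD('n)"
  have "norm (B $$ (0, 0)) \<le> b"
    using bound B unfolding norm_bound_def by auto
  then have b: "b \<ge> 0"
    using norm_ge_zero order_trans by blast
  have entry: "norm (vec_index (B *\<^sub>v vec_of_hma v) i) \<le> ?n * b * norm v" if i: "i < ?n" for i
  proof -
    have "norm (vec_index (B *\<^sub>v vec_of_hma v) i) =
        norm (\<Sum>j = 0..<?n. B $$ (i, j) * vec_nth v (enum_elem j))"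
      using i B by (simp add: vec_of_hma_def scalar_prod_def)
    also have "\<dots> \<le> (\<Sum>j = 0..<?n. norm (B $$ (i, j)) * norm (vec_nth v (enum_elem j)))"
      by (rule order_trans[OF norm_sum]) (simp add: norm_mult)
    also have "\<dots> \<le> (\<Sum>j = 0..<?n. b * norm v)"
    proof (rule sum_mono)
      fix j assume "j \<in> {0..<?n}"
      then have "norm (B $$ (i, j)) \<le> b"
        using bound i B unfolding norm_bound_def by auto
      then show "norm (B $$ (i, j)) * norm (vec_nth v (enum_elem j)) \<le> b * norm v"
        using b by (intro mult_mono Finite_Cartesian_Product.norm_nth_le) auto
    qed
    finally show ?thesis by simp
  qed
  have "norm (hma_of_vec (B *\<^sub>v vec_of_hma v) :: complex^'n)
      \<le> (\<Sum>a\<in>UNIV. norm (vec_nth (hma_of_vec (B *\<^sub>v vec_of_hma v) :: complex^'n) a))"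
    by (rule norm_le_sum_norm_nth)
  also have "\<dots> \<le> (\<Sum>a\<in>(UNIV::'n set). ?n * b * norm v)"
    by (rule sum_mono) (simp add: hma_of_vec_def entry)
  finally show ?thesis by simp
qed

lemma matrix_vector_mult_scaleR_algebra:
  fixes A :: "'a::real_algebra_1^'n^'m"
  shows "(c *\<^sub>R A) *v v = c *\<^sub>R (A *v v)" "A *v (c *\<^sub>R v) = c *\<^sub>R (A *v v)"
  by (simp_all add: vec_eq_iff matrix_vector_mult_def scaleR_sum_right)

lemma spectral_radius_mat_of_hma_nonneg:
  "Spectral_Radius.spectral_radius (mat_of_hma (M::complex^'n::finite^'n)) \<ge> 0"
  using spectral_radius_mem_max(1)[OF mat_of_hma_carrier zero_less_card_finite, of M] by auto

lemma cmod_eigenvalue_le_spectral_radius: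
  fixes M :: "complex^'n::finite^'n"
  assumes "v \<noteq> 0" "M *v v = l *s v"
  shows "cmod l \<le> Spectral_Radius.spectral_radius (mat_of_hma M)"
proof -
  have "l \<in> spectrum (mat_of_hma M)"
    using assms unfolding spectrum_def by (auto simp: eigenvalue_mat_of_hma_iff)
  then show ?thesis
    by (intro spectral_radius_mem_max(2)[OF mat_of_hma_carrier zero_less_card_finite] imageI)
qed

lemma power_bounded_if_spectral_radius_less_1:
  fixes M :: "complex^'n::finite^'n"
  assumes "Spectral_Radius.spectral_radius (mat_of_hma M) < 1"
  obtains c where "\<And>k v. norm (((*v) M ^^ k) v) \<le> c * norm v"
proof -
  let ?B = "mat_of_hma M" and ?n = "CARD('n)"
  obtain b where b: "\<And>k. norm_bound (?B ^\<^sub>m k) b"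
    using spectral_radius_jnf_norm_bound_less_1_upper_triangular[OF mat_of_hma_carrier assms]
    by blast
  have "norm (((*v) M ^^ k) v) \<le> real ?n * real ?n * b * norm v" for k v
    using norm_mult_mat_vec_le_norm_bound[OF pow_carrier_mat[OF mat_of_hma_carrier] b, where v=v]
    by (simp add: mat_of_hma_pow_mult_vec)
  then show ?thesis by (rule that)
qed

lemma exponential_decay_if_spectral_radius_less:
  fixes M :: "complex^'n::finite^'n"
  assumes rho: "Spectral_Radius.spectral_radius (mat_of_hma M) < r"
  obtains c where "c > 0" "\<And>k v. norm (((*v) M ^^ k) v) \<le> c * r ^ k * norm v"
proof -
  have r: "r > 0"
    using rho spectral_radius_mat_of_hma_nonneg[of M] by linarith
  \<comment> \<open>Scaling by 1/r brings the spectral radius below 1, where the powers are bounded.\<close>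
  define M' where "M' = (1 / r) *\<^sub>R M"
  have M: "M = r *\<^sub>R M'"
    unfolding M'_def using r by simp
  have "cmod l < 1" if l: "l \<in> spectrum (mat_of_hma M')" for l
  proof -
    obtain v where "v \<noteq> 0" "M' *v v = l *s v"
      using l unfolding spectrum_def by (auto simp: eigenvalue_mat_of_hma_iff)
    then have "M *v v = r *\<^sub>R (l *s v)"
      by (simp add: M matrix_vector_mult_scaleR_algebra)
    also have "\<dots> = (complex_of_real r * l) *s v"
      by (simp add: vec_eq_iff) (simp add: scaleR_conv_of_real)
    finally have "M *v v = (complex_of_real r * l) *s v" .
    with \<open>v \<noteq> 0\<close>
    have "cmod (complex_of_real r * l) \<le> Spectral_Radius.spectral_radius (mat_of_hma M)"
      by (rule cmod_eigenvalue_le_spectral_radius)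
    then have "r * cmod l \<le> Spectral_Radius.spectral_radius (mat_of_hma M)"
      using r by (simp add: norm_mult)
    with rho have "r * cmod l < r * 1"
      by linarith
    then show ?thesis
      using r by (simp only: mult_less_cancel_left_pos)
  qed
  then have "Spectral_Radius.spectral_radius (mat_of_hma M') < 1"
    using spectral_radius_mem_max(1)[OF mat_of_hma_carrier zero_less_card_finite, of M'] by force
  then obtain c where c: "\<And>k v. norm (((*v) M' ^^ k) v) \<le> c * norm v"
    using power_bounded_if_spectral_radius_less_1 by blast
  have powers: "((*v) M ^^ k) v = r ^ k *\<^sub>R ((*v) M' ^^ k) v" for k v
    by (induction k) (simp_all add: M matrix_vector_mult_scaleR_algebra)
  show ?thesis
  proof (rule that[of "max c 1"])
    fix k v
    have "norm (((*v) M ^^ k) v) \<le> r ^ k * (c * norm v)"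
      using r c[of k v] by (simp add: powers mult_left_mono)
    also have "\<dots> \<le> max c 1 * r ^ k * norm v"
      using r by (simp add: mult_right_mono mult.assoc mult.left_commute)
    finally show "norm (((*v) M ^^ k) v) \<le> max c 1 * r ^ k * norm v" .
  qed simp
qed

definition cvec :: "real^'n \<Rightarrow> complex^'n" where
  "cvec x = (\<chi> i. complex_of_real (x $ i))"

lemma norm_cvec [simp]: "norm (cvec x) = norm x"
  unfolding cvec_def norm_vec_def by simp

lemma cmat_mult_cvec: "cmat A *v cvec x = cvec (A *v x)"
  unfolding cmat_def cvec_def matrix_vector_mult_def by (simp add: vec_eq_iff)

lemma cmat_pow_mult_cvec: "((*v) (cmat A) ^^ k) (cvec x) = cvec (((*v) A ^^ k) x)"
  by (induction k) (simp_all add: cmat_mult_cvec)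

lemma exponential_decay_if_spectral_radius_less_1:
  fixes A :: "real^'n::finite^'n"
  assumes "Defs.spectral_radius A < 1"
  obtains c r where "c > 0" "0 < r" "r < 1"
    and "\<And>k x. norm (((*v) A ^^ k) x) \<le> c * r ^ k * norm x"
proof -
  let ?rho = "Spectral_Radius.spectral_radius (mat_of_hma (cmat A))"
  define r where "r = (?rho + 1) / 2"
  have r: "?rho < r" "0 < r" "r < 1"
    using assms spectral_radius_mat_of_hma_nonneg[of "cmat A"]
    unfolding r_def spectral_radius_cmat by auto
  obtain c where "c > 0" and c: "\<And>k v. norm (((*v) (cmat A) ^^ k) v) \<le> c * r ^ k * norm v"
    using exponential_decay_if_spectral_radius_less[OF r(1)] by blast
  have "norm (((*v) A ^^ k) x) \<le> c * r ^ k * norm x" for k x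
    using c[of k "cvec x"] by (simp add: cmat_pow_mult_cvec)
  with \<open>c > 0\<close> r show ?thesis
    using that by blast
qed

lemma cmat_powers_tendsto_zero:
  fixes A :: "real^'n::finite^'n"
  assumes "\<And>x. (\<lambda>k. ((*v) A ^^ k) x) \<longlonglongrightarrow> 0"
  shows "(\<lambda>k. ((*v) (cmat A) ^^ k) v) \<longlonglongrightarrow> 0"
proof -
  define x where "x = (\<chi> i. Re (v $ i))"
  define y where "y = (\<chi> i. Im (v $ i))"
  have v: "v = cvec x + \<i> *s cvec y"
    unfolding x_def y_def cvec_def by (simp add: vec_eq_iff complex_eq_iff)
  have powers:
    "((*v) (cmat A) ^^ k) v = cvec (((*v) A ^^ k) x) + \<i> *s cvec (((*v) A ^^ k) y)" for k
    by (induction k)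
      (simp_all add: v matrix_vector_right_distrib vector_scalar_commute cmat_mult_cvec)
  show ?thesis
  proof (rule vec_tendstoI)
    fix i
    have "(\<lambda>k. ((*v) A ^^ k) z $ i) \<longlonglongrightarrow> 0" for z
      using tendsto_vec_nth[OF assms, of z i] by simp
    then have "(\<lambda>k. of_real (((*v) A ^^ k) x $ i) + \<i> * of_real (((*v) A ^^ k) y $ i))
        \<longlonglongrightarrow> of_real 0 + \<i> * (of_real 0 :: complex)"
      by (intro tendsto_intros tendsto_of_real)
    then show "(\<lambda>k. ((*v) (cmat A) ^^ k) v $ i) \<longlonglongrightarrow> 0 $ i"
      by (simp add: powers cvec_def)
  qed
qed

lemma cmod_eigenvalue_less_1_if_powers_tendsto_zero:
  fixes M :: "complex^'n::finite^'n"
  assumes lim: "(\<lambda>k. ((*v) M ^^ k) v) \<longlonglongrightarrow> 0"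
    and "v \<noteq> 0" and eigen: "M *v v = l *s v"
  shows "cmod l < 1"
proof (rule ccontr)
  assume "\<not> cmod l < 1"
  obtain i where i: "v $ i \<noteq> 0"
    using \<open>v \<noteq> 0\<close> by (auto simp: vec_eq_iff)
  have powers: "((*v) M ^^ k) v = l ^ k *s v" for k
    by (induction k) (simp_all add: eigen vector_scalar_commute)
  have "(\<lambda>k. l ^ k * v $ i) \<longlonglongrightarrow> 0"
    using tendsto_vec_nth[OF lim, of i] by (simp add: powers)
  then have "(\<lambda>k. norm (l ^ k * v $ i)) \<longlonglongrightarrow> 0"
    by (rule tendsto_norm_zero)
  moreover have "norm (v $ i) \<le> norm (l ^ k * v $ i)" for k
    using \<open>\<not> cmod l < 1\<close>
    by (simp add: norm_mult norm_power one_le_power mult_le_cancel_right1)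
  ultimately have "norm (v $ i) \<le> 0"
    by (intro LIMSEQ_le_const) auto
  with i show False by simp
qed

lemma spectral_radius_less_1_if_powers_tendsto_zero:
  fixes A :: "real^'n::finite^'n"
  assumes "\<And>x. (\<lambda>k. ((*v) A ^^ k) x) \<longlonglongrightarrow> 0"
  shows "Defs.spectral_radius A < 1"
proof -
  obtain l where "l \<in> spectrum (mat_of_hma (cmat A))"
    and rho: "Defs.spectral_radius A = cmod l"
    using spectral_radius_mem_max(1)[OF mat_of_hma_carrier zero_less_card_finite, of "cmat A"]
    by (auto simp: spectral_radius_cmat)
  then obtain v where "v \<noteq> 0" "cmat A *v v = l *s v"
    unfolding spectrum_def by (auto simp: eigenvalue_mat_of_hma_iff)
  then show ?thesis
    unfolding rho
    using cmod_eigenvalue_less_1_if_powers_tendsto_zero cmat_powers_tendsto_zero assms by blast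
qed

lemma linear_recurrence_closed_form:
  assumes "linear f" and rec: "\<And>k. e (Suc k) = f (e k) + d k"
  shows "e k = (f ^^ k) (e 0) + (\<Sum>j<k. (f ^^ (k - Suc j)) (d j))"
proof (induction k)
  case (Suc k)
  have "(\<Sum>j<k. f ((f ^^ (k - Suc j)) (d j))) = (\<Sum>j<k. (f ^^ (Suc k - Suc j)) (d j))"
  proof (rule sum.cong)
    fix j assume "j \<in> {..<k}"
    then have "Suc k - Suc j = Suc (k - Suc j)"
      by simp
    then show "f ((f ^^ (k - Suc j)) (d j)) = (f ^^ (Suc k - Suc j)) (d j)"
      by (simp del: Suc_diff_Suc)
  qed simp
  then show ?case
    by (simp add: rec Suc linear_add[OF \<open>linear f\<close>] linear_sum[OF \<open>linear f\<close>])
qed simp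

lemma linear_recurrence_norm_bound:
  fixes f :: "'a::real_normed_vector \<Rightarrow> 'a"
  assumes "linear f" and decay: "\<And>k x. norm ((f ^^ k) x) \<le> c * r ^ k * norm x"
    and "c \<ge> 0" "0 \<le> r" "r < 1"
    and rec: "\<And>k. e (Suc k) = f (e k) + d k" and bound: "\<And>k. norm (d k) \<le> b"
  shows "norm (e k) \<le> c * r ^ k * norm (e 0) + c / (1 - r) * b"
proof -
  have "b \<ge> 0"
    using bound[of 0] norm_ge_zero order_trans by blast
  have "norm (\<Sum>j<k. (f ^^ (k - Suc j)) (d j)) \<le> (\<Sum>j<k. c * r ^ (k - Suc j) * b)"
  proof (rule order_trans[OF norm_sum sum_mono])
    fix j
    have "norm ((f ^^ (k - Suc j)) (d j)) \<le> c * r ^ (k - Suc j) * norm (d j)"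
      by (rule decay)
    also have "\<dots> \<le> c * r ^ (k - Suc j) * b"
      using \<open>c \<ge> 0\<close> \<open>r \<ge> 0\<close> bound by (intro mult_left_mono) auto
    finally show "norm ((f ^^ (k - Suc j)) (d j)) \<le> c * r ^ (k - Suc j) * b" .
  qed
  also have "\<dots> = c * b * (\<Sum>j<k. r ^ j)"
    using sum.nat_diff_reindex[of "\<lambda>j. c * r ^ j * b" k]
    by (simp add: sum_distrib_left sum_distrib_right algebra_simps)
  also have "\<dots> \<le> c * b * (1 / (1 - r))"
  proof -
    have "(\<Sum>j<k. r ^ j) = (1 - r ^ k) / (1 - r)"
      using \<open>r < 1\<close> by (simp add: sum_gp_strict)
    also have "\<dots> \<le> 1 / (1 - r)"
      using \<open>0 \<le> r\<close> \<open>r < 1\<close> by (intro divide_right_mono) auto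
    finally show ?thesis
      using \<open>c \<ge> 0\<close> \<open>b \<ge> 0\<close> by (intro mult_left_mono) auto
  qed
  also have "c * b * (1 / (1 - r)) = c / (1 - r) * b"
    by simp
  finally have "norm (\<Sum>j<k. (f ^^ (k - Suc j)) (d j)) \<le> c / (1 - r) * b" .
  moreover have "norm ((f ^^ k) (e 0)) \<le> c * r ^ k * norm (e 0)"
    by (rule decay)
  moreover have "norm (e k) \<le> norm ((f ^^ k) (e 0)) + norm (\<Sum>j<k. (f ^^ (k - Suc j)) (d j))"
    by (subst linear_recurrence_closed_form[of f e d k, OF \<open>linear f\<close> rec])
      (rule norm_triangle_ineq)
  ultimately show ?thesis
    by linarith
qed

lemma linear_recurrence_limsup_bound:
  fixes f :: "'a::real_normed_vector \<Rightarrow> 'a"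
  assumes "linear f" and decay: "\<And>k x. norm ((f ^^ k) x) \<le> c * r ^ k * norm x"
    and "c \<ge> 0" "0 \<le> r" "r < 1"
    and rec: "\<And>k. e (Suc k) = f (e k) + d k"
    and limsup_d: "limsup (\<lambda>k. ereal (norm (d k))) \<le> ereal b"
  shows "limsup (\<lambda>k. ereal (norm (e k))) \<le> ereal (c / (1 - r) * b)"
proof -
  define C where "C = c / (1 - r)"
  have "C \<ge> 0"
    unfolding C_def using \<open>c \<ge> 0\<close> \<open>r < 1\<close> by simp
  have above: "limsup (\<lambda>k. ereal (norm (e k))) \<le> ereal (C * b')" if "b < b'" for b'
  proof -
    have "\<forall>\<^sub>F j in sequentially. ereal (norm (d j)) < ereal b'"
      using that by (intro Limsup_lessD order.strict_trans1[OF limsup_d]) simp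
    then obtain m where m: "\<And>j. j \<ge> m \<Longrightarrow> norm (d j) \<le> b'"
      unfolding eventually_sequentially by (meson ereal_less_eq(3) less_imp_le)
    have rec_shift: "e (Suc k + m) = f (e (k + m)) + d (k + m)" for k
      using rec[of "k + m"] by simp
    have bound_shift: "norm (d (k + m)) \<le> b'" for k
      using m by simp
    have tail: "norm (e (k + m)) \<le> c * r ^ k * norm (e m) + C * b'" for k
    proof -
      have "norm (e (k + m)) \<le> c * r ^ k * norm (e (0 + m)) + c / (1 - r) * b'"
        by (rule linear_recurrence_norm_bound[where e="\<lambda>k. e (k + m)" and d="\<lambda>k. d (k + m)",
              OF \<open>linear f\<close> decay \<open>c \<ge> 0\<close> \<open>0 \<le> r\<close> \<open>r < 1\<close> rec_shift bound_shift])
      then show ?thesis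
        unfolding C_def by simp
    qed
    have "(\<lambda>k. r ^ (k - m)) \<longlonglongrightarrow> 0"
      by (rule LIMSEQ_offset[where k=m]) (simp add: LIMSEQ_realpow_zero \<open>0 \<le> r\<close> \<open>r < 1\<close>)
    then have "(\<lambda>k. c * r ^ (k - m) * norm (e m) + C * b') \<longlonglongrightarrow>
        c * 0 * norm (e m) + C * b'"
      by (intro tendsto_intros)
    then have "limsup (\<lambda>k. ereal (c * r ^ (k - m) * norm (e m) + C * b')) = ereal (C * b')"
      by (intro lim_imp_Limsup) (simp_all add: lim_ereal)
    moreover have "\<forall>\<^sub>F k in sequentially.
        ereal (norm (e k)) \<le> ereal (c * r ^ (k - m) * norm (e m) + C * b')"
      unfolding eventually_sequentially
    proof (intro exI allI impI)
      fix n assume "m \<le> n"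
      then show "ereal (norm (e n)) \<le> ereal (c * r ^ (n - m) * norm (e m) + C * b')"
        using tail[of "n - m"] by simp
    qed
    ultimately show ?thesis
      by (metis Limsup_mono)
  qed
  show ?thesis
  proof (rule ereal_le_epsilon2, fold C_def)
    fix \<epsilon> :: real assume "\<epsilon> > 0"
    have "limsup (\<lambda>k. ereal (norm (e k))) \<le> ereal (C * (b + \<epsilon> / (C + 1)))"
      using \<open>\<epsilon> > 0\<close> \<open>C \<ge> 0\<close> by (intro above) simp
    also have "C * (b + \<epsilon> / (C + 1)) \<le> C * b + \<epsilon>"
      using \<open>\<epsilon> > 0\<close> \<open>C \<ge> 0\<close> by (simp add: distrib_left field_simps)
    finally show "limsup (\<lambda>k. ereal (norm (e k))) \<le> ereal (C * b) + ereal \<epsilon>"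
      by simp
  qed
qed

lemma class_K_linear: "a > 0 \<Longrightarrow> class_K (\<lambda>s. a * s)"
  unfolding class_K_def strict_mono_on_def by (auto intro!: continuous_intros)

lemma class_Kinf_linear: "a > 0 \<Longrightarrow> class_Kinf (\<lambda>s. a * s)"
  unfolding class_Kinf_def
  by (auto intro!: class_K_linear
      filterlim_tendsto_pos_mult_at_top[OF tendsto_const _ filterlim_ident])

lemma class_KL_exponential:
  assumes "c > 0" "0 < r" "r < 1"
  shows "class_KL (\<lambda>s k. c * r ^ k * s)"
  unfolding class_KL_def
proof (intro conjI allI impI)
  show "class_K (\<lambda>s. c * r ^ k * s)" for k
    using assms by (intro class_K_linear) simp
  fix s :: real assume "s \<ge> 0"
  show "antimono (\<lambda>k. c * r ^ k * s)"
    using assms \<open>s \<ge> 0\<close>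
    by (intro antimonoI mult_right_mono mult_left_mono power_decreasing) auto
  have "(\<lambda>k. c * r ^ k * s) \<longlonglongrightarrow> c * 0 * s"
    using assms by (intro tendsto_intros LIMSEQ_realpow_zero) auto
  then show "(\<lambda>k. c * r ^ k * s) \<longlonglongrightarrow> 0"
    by simp
qed

lemma norm_diff_le_beta_DN:
  assumes "bounded (range N)"
  shows "norm (N (Suc k) - N k) \<le> beta_DN N"
proof -
  obtain M where M: "\<And>k. norm (N k) \<le> M"
    using assms unfolding bounded_iff by auto
  have "norm (N (Suc k) - N k) \<le> 2 * M" for k
    using norm_triangle_ineq4[of "N (Suc k)" "N k"] M[of k] M[of "Suc k"] by simp
  then have "bdd_above (range (\<lambda>k. norm (N (Suc k) - N k)))"
    by (rule bdd_aboveI2)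
  then show ?thesis
    unfolding beta_DN_def by (rule cSUP_upper[OF UNIV_I])
qed

lemma limsup_eq_beta_DN_ess:
  assumes "bounded (range N)"
  shows "limsup (\<lambda>k. ereal (norm (N (Suc k) - N k))) = ereal (beta_DN_ess N)"
proof -
  let ?L = "limsup (\<lambda>k. ereal (norm (N (Suc k) - N k)))"
  have "?L \<le> ereal (beta_DN N)"
    using norm_diff_le_beta_DN[OF assms] by (intro Limsup_bounded) auto
  moreover have "0 \<le> ?L"
    by (intro le_Limsup) auto
  ultimately have "\<bar>?L\<bar> \<noteq> \<infinity>"
    by auto
  then show ?thesis
    unfolding beta_DN_ess_def by (rule ereal_real'[symmetric])
qed

lemma ilc_error_Suc:
  "ilc_error P K Yd N U0 (Suc k) =
     (mat 1 - P ** K) *v ilc_error P K Yd N U0 k + (N k - N (Suc k))"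
proof -
  define u where "u = ilc_input P K Yd N U0 k"
  define e where "e = ilc_error P K Yd N U0 k"
  have Yd: "Yd = e + P *v u + N k"
    unfolding e_def u_def ilc_error_def by simp
  have "ilc_error P K Yd N U0 (Suc k) = Yd - (P *v u + P *v (K *v e) + N (Suc k))"
    unfolding ilc_error_def u_def e_def by (simp add: matrix_vector_right_distrib)
  also have "\<dots> = e - P *v (K *v e) + (N k - N (Suc k))"
    by (subst Yd) (simp add: algebra_simps)
  also have "\<dots> = (mat 1 - P ** K) *v e + (N k - N (Suc k))"
    by (simp add: matrix_vector_mult_diff_rdistrib matrix_vector_mul_assoc)
  finally show ?thesis
    unfolding e_def .
qed

lemma ilc_error_constant_uncertainty:
  "ilc_error P K Yd (\<lambda>_. Yd - x) 0 k = ((*v) (mat 1 - P ** K) ^^ k) x"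
  by (induction k) (simp_all add: ilc_error_Suc, simp add: ilc_error_def)

lemma powers_tendsto_zero_if_robustly_k_stable:
  assumes "robustly_k_stable P K Yd"
  shows "(\<lambda>k. ((*v) (mat 1 - P ** K) ^^ k) x) \<longlonglongrightarrow> 0"
proof -
  obtain chi1 chi2 zeta where "class_Kinf chi1" "class_KL zeta" and stable:
    "\<forall>U0 N. bounded (range N) \<longrightarrow>
       (\<exists>beta0\<ge>0. \<forall>k. norm (ilc_error P K Yd N U0 k) \<le> chi1 (beta_DN N) + zeta beta0 k)"
    using assms unfolding robustly_k_stable_def by blast
  define N :: "nat \<Rightarrow> real^_" where "N = (\<lambda>_. Yd - x)"
  have "bounded (range N)"
    unfolding N_def by simp
  then obtain beta0 where "beta0 \<ge> 0"
    and bound: "\<forall>k. norm (ilc_error P K Yd N 0 k) \<le> chi1 (beta_DN N) + zeta beta0 k"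
    using stable by blast
  have "chi1 (beta_DN N) = 0"
    using \<open>class_Kinf chi1\<close> unfolding class_Kinf_def class_K_def beta_DN_def N_def by simp
  with bound have "\<forall>k. norm (((*v) (mat 1 - P ** K) ^^ k) x) \<le> zeta beta0 k"
    unfolding N_def by (simp add: ilc_error_constant_uncertainty)
  moreover have "(\<lambda>k. zeta beta0 k) \<longlonglongrightarrow> 0"
    using \<open>class_KL zeta\<close> \<open>beta0 \<ge> 0\<close> unfolding class_KL_def by blast
  ultimately show ?thesis
    by (rule Lim_null_comparison[OF always_eventually])
qed

lemma robustly_k_stable_if_exponential_decay:
  fixes P :: "real^'m::finite^'p::finite" and K :: "real^'p^'m" and Yd :: "real^'p"
  assumes "c > 0" "0 < r" "r < 1"
    and decay: "\<And>k x. norm (((*v) (mat 1 - P ** K) ^^ k) x) \<le> c * r ^ k * norm x"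
  shows "robustly_k_stable P K Yd"
proof -
  define C where "C = c / (1 - r)"
  have Kinf: "class_Kinf (\<lambda>s. C * s)"
    unfolding C_def using assms by (intro class_Kinf_linear) simp
  have KL: "class_KL (\<lambda>s k. c * r ^ k * s)"
    by (rule class_KL_exponential[OF assms(1-3)])
  have bounds: "\<exists>beta0\<ge>0.
      (\<forall>k. norm (ilc_error P K Yd N U0 k) \<le> C * beta_DN N + c * r ^ k * beta0) \<and>
      limsup (\<lambda>k. ereal (norm (ilc_error P K Yd N U0 k))) \<le> ereal (C * beta_DN_ess N)"
    if "bounded (range N)" for U0 and N :: "nat \<Rightarrow> real^'p"
  proof -
    let ?E = "ilc_error P K Yd N U0" and ?D = "\<lambda>k. N k - N (Suc k)"
    note recurrence = matrix_vector_mul_linear decay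
      less_imp_le[OF \<open>c > 0\<close>] less_imp_le[OF \<open>0 < r\<close>] \<open>r < 1\<close> ilc_error_Suc
    have "norm (?D k) \<le> beta_DN N" for k
      using norm_diff_le_beta_DN[OF that] by (simp add: norm_minus_commute)
    then have "norm (?E k) \<le> C * beta_DN N + c * r ^ k * norm (?E 0)" for k
      using linear_recurrence_norm_bound[where e="?E" and d="?D", OF recurrence]
      unfolding C_def by (simp add: add.commute)
    moreover have "limsup (\<lambda>k. ereal (norm (?D k))) \<le> ereal (beta_DN_ess N)"
      using limsup_eq_beta_DN_ess[OF that] by (simp add: norm_minus_commute)
    then have "limsup (\<lambda>k. ereal (norm (?E k))) \<le> ereal (C * beta_DN_ess N)"
      unfolding C_def by (rule linear_recurrence_limsup_bound[where e="?E" and d="?D", OF recurrence])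
    ultimately show ?thesis
      by (intro exI[of _ "norm (?E 0)"]) simp
  qed
  show ?thesis
    unfolding robustly_k_stable_def
    by (rule exI[of _ "\<lambda>s. C * s"], rule exI[of _ "\<lambda>s. C * s"],
        rule exI[of _ "\<lambda>s k. c * r ^ k * s"]) (simp add: Kinf KL bounds)
qed

theorem theorem1:
  fixes P :: "real^'m^'p" and K :: "real^'p^'m" and Yd :: "real^'p"
  shows "robustly_k_stable P K Yd \<longleftrightarrow> spectral_radius (mat 1 - P ** K) < 1"
proof
  assume "robustly_k_stable P K Yd"
  then show "Defs.spectral_radius (mat 1 - P ** K) < 1"
    by (intro spectral_radius_less_1_if_powers_tendsto_zero
        powers_tendsto_zero_if_robustly_k_stable)
next
  assume "Defs.spectral_radius (mat 1 - P ** K) < 1"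
  then obtain c r where "c > 0" "0 < r" "r < 1"
    and "\<And>k x. norm (((*v) (mat 1 - P ** K) ^^ k) x) \<le> c * r ^ k * norm x"
    using exponential_decay_if_spectral_radius_less_1 by blast
  then show "robustly_k_stable P K Yd"
    by (rule robustly_k_stable_if_exponential_decay)
qed

end
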